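(* Consider a two-dimensional spQUBO with spatial shape $\boldsymbol{L}\in\mathbb{N}^2$ whose spatial coupling function $f\colon\mathbb{Z}^2\to\mathbb{R}$ has a locality of $\boldsymbol{R}\in\mathbb{N}^2$ with $\boldsymbol{R}<\boldsymbol{L}$. Then there exists an equivalent two-dimensional periodic spQUBO with spatial shape $\boldsymbol{L}+\boldsymbol{R}$.
   Context: Inequalities between vectors are required to hold for all elements. For $\boldsymbol{L}\in\mathbb{N}^D$ (positive entries), $[\boldsymbol{L})=\{\boldsymbol{d}\in\mathbb{Z}^D \mid \boldsymbol{0}\le\boldsymbol{d}<\boldsymbol{L}\}$. A $D$-dimensional spatial QUBO (spQUBO) is an optimization problem $$\text{maximize } F(x_1,\dots,x_N)=\frac12\sum_{i,j=1}^N c_ic_jf(\boldsymbol{d}_i-\boldsymbol{d}_j)x_ix_j+\sum_{i=1}^N b_ix_i \quad\text{subject to } x_i\in\{0,1\}\ (i=1,\dots,N),$$ where $f\colon\mathbb{Z}^D\to\mathbb{R}$ is symmetric, i.e. $f(\boldsymbol{d})=f(-\boldsymbol{d})$, each variable $x_i$ is associated with a bias $b_i\in\mathbb{R}$, a coefficient $c_i\in\mathbb{R}$ and a grid point $\boldsymbol{d}_i\in[\boldsymbol{L})$ for some $\boldsymbol{L}\in\mathbb{N}^D$, and the mapping $i\mapsto\boldsymbol{d}_i$ is injective. The function $f$ is called the spatial coupling function and $\boldsymbol{L}$ the spatial shape. A function $f$ on $\mathbb{Z}^D$ is periodic with period $\boldsymbol{L}\in\mathbb{N}^D$ if $f(\boldsymbol{d})=f(\boldsymbol{d}+\boldsymbol{k}\odot\boldsymbol{L})$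 for all $\boldsymbol{d},\boldsymbol{k}\in\mathbb{Z}^D$, where $\odot$ is the element-wise product. An spQUBO is periodic if its spatial coupling function is periodic with period equal to its spatial shape. A function $f\colon\mathbb{Z}^D\to\mathbb{R}$ has a locality of $\boldsymbol{R}\in\mathbb{N}^D$ if, for every $\boldsymbol{r}\in\mathbb{Z}^D$, $|\boldsymbol{r}|\not\le\boldsymbol{R}$ implies $f(\boldsymbol{r})=0$, where $|\cdot|$ is the element-wise absolute value. Two spQUBOs are equivalent if they are in the same binary variables $x_1,\dots,x_N$ and have the same objective function $F$ on $\{0,1\}^N$. *)

theory Defs
  imports "HOL-Analysis.Finite_Cartesian_Product" "HOL-Library.Numeral_Type"
begin

text \<open>
  The lattice of dimension D is \<open>int ^ 'd\<close> with \<open>CARD('d) = D\<close>; vectors of positive integers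
  are integer vectors satisfying \<open>positive_vec\<close>.  On vectors, the library's \<open>\<le>\<close>, \<open>+\<close> and \<open>*\<close> are
  element-wise, but its \<open><\<close> is the strict part of \<open>\<le>\<close>, which is not the element-wise strict
  inequality; hence \<open>vec_less\<close>.
\<close>

definition vec_less :: "int ^ 'd \<Rightarrow> int ^ 'd \<Rightarrow> bool" where
  "vec_less u v \<longleftrightarrow> (\<forall>i. u $ i < v $ i)"

definition positive_vec :: "int ^ 'd \<Rightarrow> bool" where
  "positive_vec L \<longleftrightarrow> vec_less 0 L"

definition grid_box :: "int ^ 'd \<Rightarrow> (int ^ 'd) set" where
  "grid_box L = {d. 0 \<le> d \<and> vec_less d L}"

definition symmetric_fun :: "(int ^ 'd \<Rightarrow> real) \<Rightarrow> bool" where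
  "symmetric_fun f \<longleftrightarrow> (\<forall>d. f d = f (- d))"

definition periodic_with :: "(int ^ 'd \<Rightarrow> real) \<Rightarrow> int ^ 'd \<Rightarrow> bool" where
  "periodic_with f L \<longleftrightarrow> (\<forall>d k. f d = f (d + k * L))"

definition has_locality :: "(int ^ 'd \<Rightarrow> real) \<Rightarrow> int ^ 'd \<Rightarrow> bool" where
  "has_locality f R \<longleftrightarrow> (\<forall>r. \<not> (\<chi> i. \<bar>r $ i\<bar>) \<le> R \<longrightarrow> f r = 0)"

text \<open>
  The variables are indexed by \<open>{1..num_vars}\<close>; the values of \<open>bias\<close>, \<open>coeff\<close> and \<open>point\<close>
  at other indices are irrelevant.
\<close>

record 'd spqubo_data =
  num_vars :: nat
  coupling :: "int ^ 'd \<Rightarrow> real"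
  shape :: "int ^ 'd"
  bias :: "nat \<Rightarrow> real"
  coeff :: "nat \<Rightarrow> real"
  point :: "nat \<Rightarrow> int ^ 'd"

definition is_spqubo :: "'d::finite spqubo_data \<Rightarrow> bool" where
  "is_spqubo Q \<longleftrightarrow>
     symmetric_fun (coupling Q) \<and>
     positive_vec (shape Q) \<and>
     (\<forall>i\<in>{1..num_vars Q}. point Q i \<in> grid_box (shape Q)) \<and>
     inj_on (point Q) {1..num_vars Q}"

definition is_periodic_spqubo :: "'d::finite spqubo_data \<Rightarrow> bool" where
  "is_periodic_spqubo Q \<longleftrightarrow> is_spqubo Q \<and> periodic_with (coupling Q) (shape Q)"

definition objective :: "'d::finite spqubo_data \<Rightarrow> (nat \<Rightarrow> real) \<Rightarrow> real" where
  "objective Q x =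
     1 / 2 * (\<Sum>i = 1..num_vars Q. \<Sum>j = 1..num_vars Q.
        coeff Q i * coeff Q j * coupling Q (point Q i - point Q j) * x i * x j)
     + (\<Sum>i = 1..num_vars Q. bias Q i * x i)"

definition feasible :: "nat \<Rightarrow> (nat \<Rightarrow> real) set" where
  "feasible N = {x. \<forall>i\<in>{1..N}. x i \<in> {0, 1}}"

definition equivalent_spqubo ::
    "'d::finite spqubo_data \<Rightarrow> 'e::finite spqubo_data \<Rightarrow> bool" where
  "equivalent_spqubo Q Q' \<longleftrightarrow>
     num_vars Q = num_vars Q' \<and>
     (\<forall>x\<in>feasible (num_vars Q). objective Q x = objective Q' x)"

end

theory Submission
  imports Defs
begin

text \<open>
  Every residue class modulo \<open>L + R\<close> has exactly one representative in the window \<open>{-R..<L}\<close>;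
  composing \<open>f\<close> with the map to this representative, taken element-wise, makes it periodic.
  A difference of grid points outside the window, below \<open>-R\<close>, moves to a representative above \<open>R\<close>,
  so locality makes \<open>f\<close> vanish at both; the same argument gives the symmetry.
\<close>

definition window_rep :: "int \<Rightarrow> int \<Rightarrow> int \<Rightarrow> int" where
  "window_rep L R z = (z + R) mod (L + R) - R"

lemma window_rep_add_mult: "window_rep L R (z + k * (L + R)) = window_rep L R z"
proof -
  have "z + k * (L + R) + R = (z + R) + k * (L + R)"
    by simp
  then show ?thesis
    unfolding window_rep_def by (metis mod_mult_self1)
qed

lemma window_rep_eq: "-R \<le> z \<Longrightarrow> z < L \<Longrightarrow> window_rep L R z = z"
  by (simp add: window_rep_def)

lemma window_rep_bounds:
  assumes "0 < L + R"
  shows "-R \<le> window_rep L R z" "window_rep L R z < L"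
  using pos_mod_bound[OF assms, of "z + R"] pos_mod_sign[OF assms, of "z + R"]
  unfolding window_rep_def by linarith+

text \<open>Only \<open>z < -R\<close> needs work: since also \<open>-L < z\<close>, a single shift
  by the period gives \<open>R < z + (L + R) < L\<close>. The shifted value thus lies in the window,
  so it is the representative, and it exceeds \<open>R\<close>.\<close>

lemma window_rep_cases:
  assumes "0 \<le> R" "R < L" "\<bar>z\<bar> < L"
  shows "window_rep L R z = z \<or> R < \<bar>window_rep L R z\<bar> \<and> R < \<bar>z\<bar>"
proof (cases "-R \<le> z")
  case True
  then show ?thesis
    using assms window_rep_eq[of R z L] by simp
next
  case False
  have "window_rep L R z = window_rep L R (z + 1 * (L + R))"
    by (simp only: window_rep_add_mult)
  also have "\<dots> = z + (L + R)"
    using False assms by (subst window_rep_eq) auto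
  finally show ?thesis
    using False assms by auto
qed

text \<open>\<open>- window_rep L R z\<close> and \<open>- z\<close> differ by a multiple of the
  period.\<close>

lemma window_rep_window_rep_uminus: "window_rep L R (- window_rep L R z) = window_rep L R (- z)"
proof -
  have "- window_rep L R z = - z + (z + R) div (L + R) * (L + R)"
    by (simp add: window_rep_def flip: minus_div_mult_eq_mod)
  then show ?thesis
    by (simp only: window_rep_add_mult)
qed

text \<open>The window is not symmetric about 0, so negating a representative may leave it. But the
  bounds \<open>-R\<close> and \<open>L\<close> with \<open>R < L\<close> keep the absolute value
  below \<open>L\<close>, so \<open>window_rep_cases\<close> applies to the negated
  representative.\<close>

lemma window_rep_uminus_cases:
  assumes "0 \<le> R" "R < L"
  shows "window_rep L R (- z) = - window_rep L R z \<or>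
         R < \<bar>window_rep L R (- z)\<bar> \<and> R < \<bar>window_rep L R z\<bar>"
proof -
  have "\<bar>- window_rep L R z\<bar> < L"
    using assms window_rep_bounds[of L R z] by simp
  from window_rep_cases[OF assms this] show ?thesis
    by (simp add: window_rep_window_rep_uminus)
qed

definition periodize :: "int ^ 'd \<Rightarrow> int ^ 'd \<Rightarrow> (int ^ 'd \<Rightarrow> real) \<Rightarrow> int ^ 'd \<Rightarrow> real" where
  "periodize L R f d = f (\<chi> i. window_rep (L $ i) (R $ i) (d $ i))"

lemma periodic_with_periodize: "periodic_with (periodize L R f) (L + R)"
  unfolding periodic_with_def periodize_def by (simp add: window_rep_add_mult)

text \<open>A single coordinate beyond \<open>R\<close> in both vectors makes \<open>f\<close>
  vanish at both. Hence the alternatives proved for integers can be used in each coordinate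
  independently.\<close>

lemma has_locality_eq:
  assumes "has_locality f R"
    and "\<And>i. u $ i = v $ i \<or> R $ i < \<bar>u $ i\<bar> \<and> R $ i < \<bar>v $ i\<bar>"
  shows "f u = f v"
proof (cases "u = v")
  case False
  then obtain i where "R $ i < \<bar>u $ i\<bar>" "R $ i < \<bar>v $ i\<bar>"
    using assms(2) by (metis vec_eq_iff)
  then have "\<not> (\<chi> i. \<bar>u $ i\<bar>) \<le> R" "\<not> (\<chi> i. \<bar>v $ i\<bar>) \<le> R"
    by (auto simp: less_eq_vec_def not_le)
  then show ?thesis
    using assms(1) by (simp add: has_locality_def)
qed simp

lemma periodize_eq:
  assumes "has_locality f R" "0 \<le> R" "vec_less R L" "vec_less (\<chi> i. \<bar>d $ i\<bar>) L"
  shows "periodize L R f d = f d"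
  unfolding periodize_def
proof (rule has_locality_eq[OF assms(1)])
  fix i
  have "0 \<le> R $ i" "R $ i < L $ i" "\<bar>d $ i\<bar> < L $ i"
    using assms(2-4) by (auto simp: less_eq_vec_def vec_less_def)
  from window_rep_cases[OF this]
  show "(\<chi> i. window_rep (L $ i) (R $ i) (d $ i)) $ i = d $ i \<or>
        R $ i < \<bar>(\<chi> i. window_rep (L $ i) (R $ i) (d $ i)) $ i\<bar> \<and> R $ i < \<bar>d $ i\<bar>"
    by simp
qed

lemma symmetric_fun_periodize:
  assumes "symmetric_fun f" "has_locality f R" "0 \<le> R" "vec_less R L"
  shows "symmetric_fun (periodize L R f)"
  unfolding symmetric_fun_def
proof
  fix d
  let ?w = "\<lambda>d. \<chi> i. window_rep (L $ i) (R $ i) (d $ i)"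
  \<comment> \<open>Symmetry of \<open>f\<close> reaches only \<open>- ?w d\<close>, which need not
    be the representative of \<open>- d\<close>; locality bridges the gap.\<close>
  have "f (?w (- d)) = f (- ?w d)"
  proof (rule has_locality_eq[OF assms(2)])
    fix i
    have "0 \<le> R $ i" "R $ i < L $ i"
      using assms(3,4) by (auto simp: less_eq_vec_def vec_less_def)
    from window_rep_uminus_cases[OF this, of "d $ i"]
    show "?w (- d) $ i = (- ?w d) $ i \<or> R $ i < \<bar>?w (- d) $ i\<bar> \<and> R $ i < \<bar>(- ?w d) $ i\<bar>"
      by simp
  qed
  also have "\<dots> = f (?w d)"
    using assms(1) by (simp add: symmetric_fun_def)
  finally show "periodize L R f d = periodize L R f (- d)"
    by (simp add: periodize_def)
qed

lemma grid_box_diff: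
  assumes "p \<in> grid_box L" "q \<in> grid_box L"
  shows "vec_less (\<chi> i. \<bar>(p - q) $ i\<bar>) L"
  unfolding vec_less_def
proof
  fix i
  have "0 \<le> p $ i" "p $ i < L $ i" "0 \<le> q $ i" "q $ i < L $ i"
    using assms by (auto simp: grid_box_def less_eq_vec_def vec_less_def)
  then show "(\<chi> i. \<bar>(p - q) $ i\<bar>) $ i < L $ i"
    by simp
qed

lemma grid_box_add: "0 \<le> R \<Longrightarrow> d \<in> grid_box L \<Longrightarrow> d \<in> grid_box (L + R)"
  by (auto simp: grid_box_def vec_less_def less_eq_vec_def intro: add_strict_increasing2 less_le_trans)

lemma equivalent_periodic_spqubo:
  fixes Q :: "'d::finite spqubo_data"
  assumes Q: "is_spqubo Q" and R: "0 \<le> R" "has_locality (coupling Q) R" "vec_less R (shape Q)"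
  defines "Q' \<equiv> Q\<lparr>coupling := periodize (shape Q) R (coupling Q), shape := shape Q + R\<rparr>"
  shows "is_periodic_spqubo Q'" "equivalent_spqubo Q Q'"
proof -
  have box: "point Q i \<in> grid_box (shape Q)" if "i \<in> {1..num_vars Q}" for i
    using Q that by (auto simp: is_spqubo_def)
  have "symmetric_fun (coupling Q')" "periodic_with (coupling Q') (shape Q')"
    using Q R by (simp_all add: Q'_def is_spqubo_def symmetric_fun_periodize periodic_with_periodize)
  moreover have "positive_vec (shape Q')"
    using Q R(1) by (simp add: Q'_def is_spqubo_def positive_vec_def vec_less_def less_eq_vec_def
        add_pos_nonneg)
  moreover have "inj_on (point Q') {1..num_vars Q'}"
    using Q by (simp add: Q'_def is_spqubo_def)
  ultimately show "is_periodic_spqubo Q'"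
    using grid_box_add[OF R(1) box] by (simp add: is_periodic_spqubo_def is_spqubo_def Q'_def)
  \<comment> \<open>Points, coefficients and biases are unchanged, so the objectives agree once the
    couplings agree on differences of grid points. These are element-wise below
    \<open>shape Q\<close> in absolute value.\<close>
  have "coupling Q' (point Q i - point Q j) = coupling Q (point Q i - point Q j)"
    if "i \<in> {1..num_vars Q}" "j \<in> {1..num_vars Q}" for i j
    using periodize_eq[OF R(2,1,3) grid_box_diff[OF box box]] that by (simp add: Q'_def)
  then have "objective Q x = objective Q' x" for x
    by (simp add: objective_def Q'_def)
  then show "equivalent_spqubo Q Q'"
    by (simp add: equivalent_spqubo_def Q'_def)
qed

theorem theorem1:
  fixes Q :: "2 spqubo_data" and R :: "int ^ 2"
  assumes "is_spqubo Q"
    and "positive_vec R"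
    and "has_locality (coupling Q) R"
    and "vec_less R (shape Q)"
  shows "\<exists>Q' :: 2 spqubo_data.
           is_periodic_spqubo Q' \<and> shape Q' = shape Q + R \<and> equivalent_spqubo Q Q'"
proof -
  have "0 \<le> R"
    using assms(2) by (simp add: positive_vec_def vec_less_def less_eq_vec_def less_imp_le)
  from equivalent_periodic_spqubo[OF assms(1) this assms(3,4)] show ?thesis
    by (intro exI conjI) simp_all
qed

end
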